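(* Let $h>0$, let $\varphi:\mathbb{R}\to\mathbb{R}$ be a limiter satisfying $$\max(0,r)\le\varphi(r)\le1\ (r\le1),\qquad 1\le\varphi(r)\le\min(r,2)\ (r\ge1),\qquad \varphi(r)\le r\,\varphi(1/r)\ (r\ge1),$$ such that $L_\varphi$ is Lipschitz continuous on $\mathbb{R}^3$, and suppose that for some real $\alpha$ with $1\le\alpha\le2$ $$\varphi(r)\le(\alpha-2)\,r\ (r\le0),\qquad \varphi(r)\le\alpha\ (r>0).$$ Let $\Phi:\mathbb{R}^2\to\mathbb{R}$ be a consistent numerical flux, Lipschitz continuous on the compact sets of $\mathbb{R}^2$, absolutely continuous with respect to each variable, $$\Phi(u,v)=\Phi(u_0,v)+\int_{u_0}^u\Phi_u(\xi,v)\,d\xi,\qquad \Phi(u,v)=\Phi(u,v_0)+\int_{v_0}^v\Phi_v(u,\xi)\,d\xi,$$ and monotone: $\Phi_u\ge0$, $\Phi_v\le0$. Let $(u_j^0)_{j\in\mathbb{Z}}$ satisfy $\sup_j|u_j^0|<\infty$ and $\sum_{j}|u_{j+1}^0-u_j^0|<\infty$, let $T>0$, and let $(u_j(t))_{j\in\mathbb{Z}}$, $t\in[0,T]$, in $C^1([0,T];\ell^\infty(\mathbb{Z}))$, be the solution of $$\frac{du_j}{dt}+\frac1h\Big(\Phi(u_{j+1/2}^-,u_{j+1/2}^+)-\Phi(u_{j-1/2}^-,u_{j-1/2}^+)\Big)=0,\qquad u_j(0)=u_j^0\qquad(j\in\mathbb{Z}).$$ Then the total variation $\mathrm{TV}(t)=\sum_{j\in\mathbb{Z}}|u_{j+1}(t)-u_j(t)|$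 is a decreasing function of time: $$\mathrm{TV}(t+\theta)\le\mathrm{TV}(t)\qquad\text{whenever }0\le t\le t+\theta\le T.$$
   Context: Interpolation: for $\varphi:\mathbb{R}\to\mathbb{R}$, put $L_\varphi(u,v,w)=v+\frac12\varphi\big(\frac{v-u}{w-v}\big)(w-v)$ if $w\neq v$, $L_\varphi(u,v,v)=v$, and $R_\varphi(u,v,w)=L_\varphi(w,v,u)$. For a real sequence $(u_j)_{j\in\mathbb{Z}}$ the interpolated values are $u_{j+1/2}^-=L_\varphi(u_{j-1},u_j,u_{j+1})$ and $u_{j+1/2}^+=R_\varphi(u_j,u_{j+1},u_{j+2})$. Flux: $f:\mathbb{R}\to\mathbb{R}$ is a convex $C^2$ function; $\Phi$ is consistent if $\Phi(u,u)=f(u)$ for all $u$. *)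

theory Defs
  imports "HOL-Analysis.Analysis"
begin

definition interp_L :: "(real \<Rightarrow> real) \<Rightarrow> real \<Rightarrow> real \<Rightarrow> real \<Rightarrow> real" where
  "interp_L \<phi> u v w = (if w = v then v else v + 1/2 * \<phi> ((v - u) / (w - v)) * (w - v))"

definition interp_R :: "(real \<Rightarrow> real) \<Rightarrow> real \<Rightarrow> real \<Rightarrow> real \<Rightarrow> real" where
  "interp_R \<phi> u v w = interp_L \<phi> w v u"

(* Half-integer positions are indexed by the integer to their left: the index j below
   stands for the position j + 1/2. *)

definition half_minus :: "(real \<Rightarrow> real) \<Rightarrow> (int \<Rightarrow> real) \<Rightarrow> int \<Rightarrow> real" where
  "half_minus \<phi> u j = interp_L \<phi> (u (j - 1)) (u j) (u (j + 1))"

definition half_plus :: "(real \<Rightarrow> real) \<Rightarrow> (int \<Rightarrow> real) \<Rightarrow> int \<Rightarrow> real" where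
  "half_plus \<phi> u j = interp_R \<phi> (u j) (u (j + 1)) (u (j + 2))"

definition half_flux ::
  "(real \<Rightarrow> real) \<Rightarrow> (real \<times> real \<Rightarrow> real) \<Rightarrow> (int \<Rightarrow> real) \<Rightarrow> int \<Rightarrow> real" where
  "half_flux \<phi> \<Phi> u j = \<Phi> (half_minus \<phi> u j, half_plus \<phi> u j)"

definition C2_function :: "(real \<Rightarrow> real) \<Rightarrow> bool" where
  "C2_function f \<longleftrightarrow> f C1_differentiable_on UNIV \<and> deriv f C1_differentiable_on UNIV"

definition consistent_flux :: "(real \<Rightarrow> real) \<Rightarrow> (real \<times> real \<Rightarrow> real) \<Rightarrow> bool" where
  "consistent_flux f \<Phi> \<longleftrightarrow> (\<forall>u. \<Phi> (u, u) = f u)"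

(* g is (locally) absolutely continuous on the line and g' is a representative of its
   almost everywhere defined derivative. *)

definition abs_continuous_with_deriv :: "(real \<Rightarrow> real) \<Rightarrow> (real \<Rightarrow> real) \<Rightarrow> bool" where
  "abs_continuous_with_deriv g g' \<longleftrightarrow>
     (AE x in lebesgue. (g has_real_derivative g' x) (at x)) \<and>
     (\<forall>a b. interval_lebesgue_integrable lebesgue (ereal a) (ereal b) g' \<and>
            g b = g a + (LINT \<xi>=ereal a..ereal b|lebesgue. g' \<xi>))"

(* The space of bounded sequences indexed by the integers is the type of bounded continuous
   functions on the discrete space int, with the supremum norm. The derivative is one-sided
   at the end points of the interval, whereas C1_differentiable_on uses two-sided ones. *)

definition C1_bounded_seq :: "real \<Rightarrow> (real \<Rightarrow> (int \<Rightarrow>\<^sub>C real)) \<Rightarrow> bool" where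
  "C1_bounded_seq T u \<longleftrightarrow>
     (\<exists>u'. continuous_on {0..T} u' \<and>
           (\<forall>t\<in>{0..T}. (u has_vector_derivative u' t) (at t within {0..T})))"

definition semidiscrete_solution ::
  "real \<Rightarrow> (real \<Rightarrow> real) \<Rightarrow> (real \<times> real \<Rightarrow> real) \<Rightarrow> real \<Rightarrow> (int \<Rightarrow> real) \<Rightarrow>
     (real \<Rightarrow> (int \<Rightarrow>\<^sub>C real)) \<Rightarrow> bool" where
  "semidiscrete_solution h \<phi> \<Phi> T u0 u \<longleftrightarrow>
     C1_bounded_seq T u \<and>
     (\<forall>j. apply_bcontfun (u 0) j = u0 j) \<and>
     (\<forall>t\<in>{0..T}. \<forall>j.
        ((\<lambda>s. apply_bcontfun (u s) j) has_real_derivative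
          - (1 / h) * (half_flux \<phi> \<Phi> (apply_bcontfun (u t)) j
                     - half_flux \<phi> \<Phi> (apply_bcontfun (u t)) (j - 1)))
        (at t within {0..T}))"

(* Extended-real valued, so that a divergent series has total variation infinity. *)

definition total_variation :: "(int \<Rightarrow> real) \<Rightarrow> ennreal" where
  "total_variation v = (\<Sum>\<^sub>\<infinity>j. ennreal \<bar>v (j + 1) - v j\<bar>)"

end

theory Submission
  imports Defs
begin

text \<open>
  The scheme is total variation diminishing because it can be written in Harten's incremental
  form. Let \<open>d j = u (j + 1) - u j\<close>, and let \<open>L j\<close>, \<open>R j\<close> be the interpolated values to the left
  and to the right of the position \<open>j + 1/2\<close>. Adding and subtracting \<open>\<Phi> (L j, R (j - 1))\<close>, the
  time derivative of \<open>u j\<close> becomes \<open>(p j - q j) / h\<close> with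
  \<open>p j = \<Phi> (L j, R (j - 1)) - \<Phi> (L j, R j)\<close> and
  \<open>q j = \<Phi> (L j, R (j - 1)) - \<Phi> (L (j - 1), R (j - 1))\<close>. The conditions on the limiter make
  \<open>L j - L (j - 1)\<close> a nonnegative bounded multiple of \<open>d (j - 1)\<close>, and \<open>R j - R (j - 1)\<close> one of
  \<open>d j\<close> (\<open>interp_L_increment\<close>). Since \<open>\<Phi>\<close> is monotone and locally Lipschitz, \<open>p j\<close> has the sign of
  \<open>d j\<close>, \<open>q j\<close> has the sign of \<open>d (j - 1)\<close>, and both are bounded by a constant \<open>M\<close> times the
  respective difference.

  Hence \<open>sgn (d j)\<close> times the time derivative of \<open>d j\<close> is at most \<open>(a (j + 1) - a j) / h\<close>, where
  \<open>a j = \<bar>p j\<bar> - \<bar>q j\<bar>\<close>, and formally the sum over \<open>j\<close> telescopes to zero. As the sum is infinite,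
  it is weighted by the tent \<open>w j = max 0 (1 - \<bar>j\<bar> / K)\<close>. Summation by parts then bounds the
  growth rate of \<open>\<Sum>j. w j * \<bar>d j\<bar>\<close> by \<open>2 M / (h K)\<close> times the variation of \<open>u\<close> over a window of
  length about \<open>2 K\<close> (\<open>incremental_form_rate\<close>). This estimate is used twice
  (\<open>incremental_form_TVD\<close>): since \<open>u\<close> is bounded, the window variation is \<open>O(K)\<close>, so a finite total
  variation stays bounded in time; with that bound, the growth rate is \<open>O(1 / K)\<close> and vanishes as
  \<open>K\<close> tends to infinity. If the total variation is infinite at the earlier time there is nothing
  to prove.
\<close>

section \<open>Growth of weighted sums of absolute values\<close>

lemma nonincreasing_if_left_descent:
  fixes g :: "real \<Rightarrow> real"
  assumes "a \<le> b" and cont: "continuous_on {a..b} g"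
    and descent: "\<And>t. a < t \<Longrightarrow> t \<le> b \<Longrightarrow> \<exists>s. a \<le> s \<and> s < t \<and> g t \<le> g s"
  shows "g b \<le> g a"
proof (rule ccontr)
  assume less: "\<not> g b \<le> g a"
  \<comment> \<open>At the least point where \<open>g\<close> reaches \<open>g b\<close>, the descent property yields a smaller one.\<close>
  define S where "S = {a..b} \<inter> g -` {g b..}"
  have "closed S"
    unfolding S_def by (intro continuous_closed_preimage cont) auto
  moreover have "S \<subseteq> {a..b}"
    by (auto simp: S_def)
  ultimately have "compact S"
    using compact_Icc by (metis compact_Int_closed inf.absorb_iff2 inf_commute)
  moreover have "b \<in> S"
    using \<open>a \<le> b\<close> by (auto simp: S_def)
  ultimately obtain m where m: "m \<in> S" "\<And>t. t \<in> S \<Longrightarrow> m \<le> t"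
    using compact_attains_inf[of S] by blast
  have "m \<noteq> a"
    using m(1) less by (auto simp: S_def)
  then have "a < m" "m \<le> b"
    using m(1) by (auto simp: S_def)
  then obtain s where s: "a \<le> s" "s < m" "g m \<le> g s"
    using descent by blast
  then have "s \<in> S"
    using m(1) by (auto simp: S_def)
  then show False
    using m(2) s(2) by fastforce
qed

text \<open>
  The absolute value is not differentiable at zero, but one-sided information suffices:
  \<open>\<bar>x(t)\<bar> - \<bar>x(s)\<bar> \<le> sgn(x(t)) (x(t) - x(s))\<close> holds always, so that \<open>sgn(x(t)) x'(t)\<close>
  controls the growth of \<open>\<bar>x\<bar>\<close> from the left of \<open>t\<close>.
\<close>

lemma weighted_abs_sum_growth:
  fixes x x' :: "real \<Rightarrow> 'i \<Rightarrow> real" and w :: "'i \<Rightarrow> real"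
  assumes "a \<le> b" and w: "\<And>j. j \<in> J \<Longrightarrow> 0 \<le> w j"
    and deriv: "\<And>t j. t \<in> {a..b} \<Longrightarrow> j \<in> J \<Longrightarrow>
      ((\<lambda>s. x s j) has_real_derivative x' t j) (at t within {a..b})"
    and rate: "\<And>t. t \<in> {a..b} \<Longrightarrow> (\<Sum>j\<in>J. w j * (sgn (x t j) * x' t j)) \<le> \<kappa>"
  shows "(\<Sum>j\<in>J. w j * \<bar>x b j\<bar>) \<le> (\<Sum>j\<in>J. w j * \<bar>x a j\<bar>) + \<kappa> * (b - a)"
proof -
  define V where "V t = (\<Sum>j\<in>J. w j * \<bar>x t j\<bar>)" for t
  have cont_x: "continuous_on {a..b} (\<lambda>s. x s j)" if "j \<in> J" for j
    using deriv that
    by (meson DERIV_continuous continuous_on_eq_continuous_within)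
  have cont_V: "continuous_on {a..b} V"
    unfolding V_def by (intro continuous_intros cont_x)
  have approx: "V b \<le> V a + (\<kappa> + e) * (b - a)" if "e > 0" for e
  proof -
    have "V b - (\<kappa> + e) * b \<le> V a - (\<kappa> + e) * a"
    proof (rule nonincreasing_if_left_descent[OF \<open>a \<le> b\<close>])
      show "continuous_on {a..b} (\<lambda>t. V t - (\<kappa> + e) * t)"
        by (intro continuous_intros cont_V)
    next
      fix t assume t: "a < t" "t \<le> b"
      \<comment> \<open>Freezing the signs at time \<open>t\<close> gives a differentiable minorant of \<open>V\<close>
          that touches \<open>V\<close> at \<open>t\<close>.\<close>
      define \<psi> where "\<psi> s = (\<Sum>j\<in>J. w j * (sgn (x t j) * x s j))" for s
      have "(\<psi> has_real_derivative (\<Sum>j\<in>J. w j * (sgn (x t j) * x' t j))) (at t within {a..b})"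
        unfolding \<psi>_def using t by (intro DERIV_sum DERIV_cmult deriv) auto
      then have "((\<lambda>s. \<psi> s - (\<kappa> + e) * s) has_real_derivative
          (\<Sum>j\<in>J. w j * (sgn (x t j) * x' t j)) - (\<kappa> + e) * 1) (at t within {a..b})"
        by (intro DERIV_diff DERIV_cmult DERIV_ident)
      moreover have "(\<Sum>j\<in>J. w j * (sgn (x t j) * x' t j)) - (\<kappa> + e) * 1 < 0"
        using rate[of t] t \<open>e > 0\<close> by auto
      ultimately obtain d where d: "d > 0"
        "\<And>k. k > 0 \<Longrightarrow> t - k \<in> {a..b} \<Longrightarrow> k < d \<Longrightarrow>
          \<psi> t - (\<kappa> + e) * t < \<psi> (t - k) - (\<kappa> + e) * (t - k)"
        using has_real_derivative_neg_dec_left by blast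
      define s where "s = t - min (d / 2) (t - a)"
      have s: "a \<le> s" "s < t"
        using t d(1) by (auto simp: s_def)
      have "\<psi> t = V t"
        unfolding \<psi>_def V_def by (simp add: sgn_mult_self_eq abs_sgn mult.commute)
      moreover have "\<psi> s \<le> V s"
        unfolding \<psi>_def V_def
        by (intro sum_mono mult_left_mono w) (auto simp: sgn_real_def)
      moreover have "\<psi> t - (\<kappa> + e) * t < \<psi> s - (\<kappa> + e) * s"
        using d(2)[of "min (d / 2) (t - a)"] d(1) t s by (auto simp: s_def)
      ultimately show "\<exists>s. a \<le> s \<and> s < t \<and> V t - (\<kappa> + e) * t \<le> V s - (\<kappa> + e) * s"
        using s by (intro exI[of _ s]) linarith
    qed
    then show ?thesis
      by (simp add: algebra_simps)
  qed
  have "V b \<le> V a + \<kappa> * (b - a)"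
  proof (rule field_le_epsilon)
    fix e :: real assume "e > 0"
    have "V b \<le> V a + (\<kappa> + e / (b - a + 1)) * (b - a)"
      using \<open>e > 0\<close> \<open>a \<le> b\<close> by (intro approx) auto
    moreover have "e / (b - a + 1) * (b - a) \<le> e"
      using \<open>e > 0\<close> \<open>a \<le> b\<close> by (simp add: field_simps)
    ultimately show "V b \<le> V a + \<kappa> * (b - a) + e"
      by (simp add: algebra_simps)
  qed
  then show ?thesis
    by (simp add: V_def)
qed

section \<open>Tent weights on the integers\<close>

text \<open>
  The piecewise linear weight with value 1 at the origin, slope \<open>1 / K\<close> in absolute value and
  support in \<open>[-K, K]\<close>. It is meant for \<open>K > 0\<close>; for \<open>K = 0\<close> division by zero makes it
  constantly 1.
\<close>

definition tent :: "nat \<Rightarrow> int \<Rightarrow> real" where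
  "tent K j = max 0 (1 - \<bar>real_of_int j\<bar> / real K)"

lemma tent_nonneg: "0 \<le> tent K j"
  by (simp add: tent_def)

lemma tent_le_1: "tent K j \<le> 1"
  by (simp add: tent_def)

lemma tent_eq_0: "K > 0 \<Longrightarrow> int K \<le> \<bar>j\<bar> \<Longrightarrow> tent K j = 0"
  by (auto simp: tent_def field_simps max_def)

lemma tent_lipschitz: "K > 0 \<Longrightarrow> \<bar>tent K (j - 1) - tent K j\<bar> \<le> 1 / real K"
proof -
  assume K: "K > 0"
  have "\<bar>tent K (j - 1) - tent K j\<bar>
      \<le> \<bar>\<bar>real_of_int (j - 1)\<bar> / real K - \<bar>real_of_int j\<bar> / real K\<bar>"
    unfolding tent_def by linarith
  also have "\<dots> = \<bar>\<bar>real_of_int (j - 1)\<bar> - \<bar>real_of_int j\<bar>\<bar> / real K"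
    by (simp flip: diff_divide_distrib)
  also have "\<dots> \<le> 1 / real K"
    using K by (intro divide_right_mono) auto
  finally show ?thesis .
qed

lemma tent_tendsto_1: "(\<lambda>K. tent K j) \<longlonglongrightarrow> 1"
proof -
  have "(\<lambda>K. max 0 (1 - \<bar>real_of_int j\<bar> / real K)) \<longlonglongrightarrow> max 0 (1 - 0)"
    by (intro tendsto_intros tendsto_divide_0[OF tendsto_const]
        filterlim_at_top_imp_at_infinity filterlim_real_sequentially)
  then show ?thesis
    by (simp add: tent_def)
qed

text \<open>There are no boundary terms, because the tent vanishes at \<open>-K - 1\<close> and \<open>K\<close>.\<close>

lemma tent_summation_by_parts:
  fixes a :: "int \<Rightarrow> real"
  assumes K: "K > 0"
  shows "(\<Sum>j\<in>{-int K..int K}. tent K j * (a (j + 1) - a j))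
       = (\<Sum>j\<in>{-int K..int K}. (tent K (j - 1) - tent K j) * a j)"
proof -
  have "(\<Sum>j\<in>{-int K..int K}. tent K j * a (j + 1))
      = (\<Sum>j\<in>{-int K+1..int K+1}. tent K (j - 1) * a j)"
    by (rule sum.reindex_bij_witness[of _ "\<lambda>j. j - 1" "\<lambda>j. j + 1"]) auto
  also have "\<dots> = (\<Sum>j\<in>{-int K..int K}. tent K (j - 1) * a j)"
    using K by (intro sum.mono_neutral_cong) (auto intro!: tent_eq_0)
  finally show ?thesis
    by (simp add: right_diff_distrib left_diff_distrib sum_subtractf)
qed

lemma finite_sums_le_if_tent_sums_le:
  fixes d :: "int \<Rightarrow> real"
  assumes bound: "\<And>K. K > 0 \<Longrightarrow> (\<Sum>j\<in>{-int K..int K}. tent K j * \<bar>d j\<bar>) \<le> X + c / real K"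
    and F: "finite F"
  shows "(\<Sum>j\<in>F. \<bar>d j\<bar>) \<le> X"
proof (rule tendsto_le[OF sequentially_bot])
  show "(\<lambda>K. \<Sum>j\<in>F. tent K j * \<bar>d j\<bar>) \<longlonglongrightarrow> (\<Sum>j\<in>F. \<bar>d j\<bar>)"
    using tendsto_sum[of F "\<lambda>j K. tent K j * \<bar>d j\<bar>" "\<lambda>j. 1 * \<bar>d j\<bar>" sequentially]
      tendsto_mult_right[OF tent_tendsto_1] by simp
  have "(\<lambda>K. X + c / real K) \<longlonglongrightarrow> X + 0"
    by (intro tendsto_intros tendsto_divide_0[OF tendsto_const]
        filterlim_at_top_imp_at_infinity filterlim_real_sequentially)
  then show "(\<lambda>K. X + c / real K) \<longlonglongrightarrow> X"
    by simp
  show "\<forall>\<^sub>F K in sequentially. (\<Sum>j\<in>F. tent K j * \<bar>d j\<bar>) \<le> X + c / real K"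
    using eventually_gt_at_top[of 0]
  proof eventually_elim
    case (elim K)
    have "(\<Sum>j\<in>F. tent K j * \<bar>d j\<bar>) = (\<Sum>j\<in>F \<inter> {-int K..int K}. tent K j * \<bar>d j\<bar>)"
      using F elim by (intro sum.mono_neutral_right) (auto intro!: tent_eq_0)
    also have "\<dots> \<le> (\<Sum>j\<in>{-int K..int K}. tent K j * \<bar>d j\<bar>)"
      by (intro sum_mono2) (auto simp: tent_nonneg)
    also have "\<dots> \<le> X + c / real K"
      using elim by (rule bound)
    finally show ?case .
  qed
qed

section \<open>Equations in incremental form\<close>

lemma incremental_form_rate:
  fixes d p q :: "int \<Rightarrow> real"
  assumes K: "K > 0" and M: "0 \<le> M"
    and p: "\<And>j. sgn (d j) * p j = \<bar>p j\<bar>" "\<And>j. \<bar>p j\<bar> \<le> M * \<bar>d j\<bar>"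
    and q: "\<And>j. sgn (d (j - 1)) * q j = \<bar>q j\<bar>" "\<And>j. \<bar>q j\<bar> \<le> M * \<bar>d (j - 1)\<bar>"
  shows "(\<Sum>j\<in>{-int K..int K}.
            tent K j * (sgn (d j) * ((p (j + 1) - q (j + 1)) - (p j - q j))))
       \<le> 2 * M / real K * (\<Sum>j\<in>{-int K - 1..int K}. \<bar>d j\<bar>)"
proof -
  let ?J = "{-int K..int K}" and ?S = "\<Sum>j\<in>{-int K - 1..int K}. \<bar>d j\<bar>"
  define a where "a j = \<bar>p j\<bar> - \<bar>q j\<bar>" for j
  have sgn_le: "sgn x * y \<le> \<bar>y\<bar>" for x y :: real
    by (auto simp: sgn_real_def)
  have "sgn (d j) * ((p (j + 1) - q (j + 1)) - (p j - q j)) \<le> a (j + 1) - a j" for j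
    using sgn_le[of "d j" "p (j + 1)"] sgn_le[of "d j" "q j"] p(1)[of j] q(1)[of "j + 1"]
    by (simp add: a_def right_diff_distrib)
  then have "(\<Sum>j\<in>?J. tent K j * (sgn (d j) * ((p (j + 1) - q (j + 1)) - (p j - q j))))
      \<le> (\<Sum>j\<in>?J. tent K j * (a (j + 1) - a j))"
    by (intro sum_mono mult_left_mono) (auto simp: tent_nonneg)
  also have "\<dots> = (\<Sum>j\<in>?J. (tent K (j - 1) - tent K j) * a j)"
    by (rule tent_summation_by_parts[OF K])
  also have "\<dots> \<le> (\<Sum>j\<in>?J. 1 / real K * (M * \<bar>d j\<bar> + M * \<bar>d (j - 1)\<bar>))"
  proof (rule sum_mono)
    fix j
    have "(tent K (j - 1) - tent K j) * a j \<le> \<bar>tent K (j - 1) - tent K j\<bar> * \<bar>a j\<bar>"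
      by (metis abs_ge_self abs_mult)
    also have "\<dots> \<le> 1 / real K * (M * \<bar>d j\<bar> + M * \<bar>d (j - 1)\<bar>)"
      using p(2)[of j] q(2)[of j]
      by (intro mult_mono tent_lipschitz K) (auto simp: a_def)
    finally show "(tent K (j - 1) - tent K j) * a j
        \<le> 1 / real K * (M * \<bar>d j\<bar> + M * \<bar>d (j - 1)\<bar>)" .
  qed
  also have "\<dots> = M / real K * ((\<Sum>j\<in>?J. \<bar>d j\<bar>) + (\<Sum>j\<in>?J. \<bar>d (j - 1)\<bar>))"
    by (simp add: sum_distrib_left sum.distrib add_divide_distrib distrib_left)
  also have "(\<Sum>j\<in>?J. \<bar>d (j - 1)\<bar>) = (\<Sum>j\<in>{-int K - 1..int K - 1}. \<bar>d j\<bar>)"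
    by (rule sum.reindex_bij_witness[of _ "\<lambda>j. j + 1" "\<lambda>j. j - 1"]) auto
  also have "M / real K * ((\<Sum>j\<in>?J. \<bar>d j\<bar>) + (\<Sum>j\<in>{-int K - 1..int K - 1}. \<bar>d j\<bar>))
      \<le> M / real K * (?S + ?S)"
    using M by (intro mult_left_mono add_mono sum_mono2) auto
  finally show ?thesis
    by (simp add: mult_ac)
qed

text \<open>
  Harten's principle for sequences indexed by all integers. Here \<open>x\<close> is the sequence of
  differences; its variation is expressed by bounds on finite partial sums.
\<close>

lemma incremental_form_TVD:
  fixes x p q :: "real \<Rightarrow> int \<Rightarrow> real"
  assumes ab: "a \<le> b" and h: "h > 0" and M: "0 \<le> M"
    and deriv: "\<And>t j. t \<in> {a..b} \<Longrightarrow> ((\<lambda>s. x s j) has_real_derivative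
        1 / h * ((p t (j + 1) - q t (j + 1)) - (p t j - q t j))) (at t within {a..b})"
    and p: "\<And>t j. t \<in> {a..b} \<Longrightarrow> sgn (x t j) * p t j = \<bar>p t j\<bar>"
      "\<And>t j. t \<in> {a..b} \<Longrightarrow> \<bar>p t j\<bar> \<le> M * \<bar>x t j\<bar>"
    and q: "\<And>t j. t \<in> {a..b} \<Longrightarrow> sgn (x t (j - 1)) * q t j = \<bar>q t j\<bar>"
      "\<And>t j. t \<in> {a..b} \<Longrightarrow> \<bar>q t j\<bar> \<le> M * \<bar>x t (j - 1)\<bar>"
    and bounded: "\<And>t j. t \<in> {a..b} \<Longrightarrow> \<bar>x t j\<bar> \<le> B"
    and init: "\<And>F. finite F \<Longrightarrow> (\<Sum>j\<in>F. \<bar>x a j\<bar>) \<le> Q"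
    and F: "finite F"
  shows "(\<Sum>j\<in>F. \<bar>x b j\<bar>) \<le> Q"
proof -
  have tent_growth: "(\<Sum>j\<in>{-int K..int K}. tent K j * \<bar>x t j\<bar>)
      \<le> Q + 2 * M / (h * real K) * S * (t - a)"
    if K: "K > 0" and t: "t \<in> {a..b}"
      and S: "\<And>s. s \<in> {a..b} \<Longrightarrow> (\<Sum>j\<in>{-int K - 1..int K}. \<bar>x s j\<bar>) \<le> S" for K t S
  proof -
    let ?J = "{-int K..int K}"
    let ?y = "\<lambda>s j. (p s (j + 1) - q s (j + 1)) - (p s j - q s j)"
    have "(\<Sum>j\<in>?J. tent K j * \<bar>x t j\<bar>)
        \<le> (\<Sum>j\<in>?J. tent K j * \<bar>x a j\<bar>) + 2 * M / (h * real K) * S * (t - a)"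
    proof (rule weighted_abs_sum_growth)
      show "a \<le> t"
        using t by simp
      show "0 \<le> tent K j" for j
        by (rule tent_nonneg)
      show "((\<lambda>s. x s j) has_real_derivative 1 / h * ?y s j) (at s within {a..t})"
        if "s \<in> {a..t}" for s j
        using that t by (intro DERIV_subset[OF deriv]) auto
      fix s assume "s \<in> {a..t}"
      then have s: "s \<in> {a..b}"
        using t by auto
      have "(\<Sum>j\<in>?J. tent K j * (sgn (x s j) * (1 / h * ?y s j)))
          = 1 / h * (\<Sum>j\<in>?J. tent K j * (sgn (x s j) * ?y s j))"
        by (simp add: sum_distrib_left mult_ac)
      also have "\<dots> \<le> 1 / h * (2 * M / real K * (\<Sum>j\<in>{-int K - 1..int K}. \<bar>x s j\<bar>))"
        using h s by (intro mult_left_mono incremental_form_rate K M p q) auto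
      also have "\<dots> \<le> 1 / h * (2 * M / real K * S)"
        using h M s by (intro mult_left_mono S) auto
      finally show "(\<Sum>j\<in>?J. tent K j * (sgn (x s j) * (1 / h * ?y s j)))
          \<le> 2 * M / (h * real K) * S"
        by simp
    qed
    moreover have "(\<Sum>j\<in>?J. tent K j * \<bar>x a j\<bar>) \<le> (\<Sum>j\<in>?J. 1 * \<bar>x a j\<bar>)"
      by (intro sum_mono mult_right_mono tent_le_1) auto
    ultimately show ?thesis
      using init[of ?J] by simp
  qed
  have B: "0 \<le> B"
    using bounded[of a 0] ab by auto
  \<comment> \<open>The sup bound controls the window sums by a multiple of \<open>K\<close>, which the
      slope \<open>1 / K\<close> of the tent compensates: the variation stays finite.\<close>
  define Q' where "Q' = Q + 8 * M / h * B * (b - a)"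
  have TV_bound: "(\<Sum>j\<in>F. \<bar>x t j\<bar>) \<le> Q'" if t: "t \<in> {a..b}" and F: "finite F" for t F
  proof (rule finite_sums_le_if_tent_sums_le[where c = 0, OF _ F])
    fix K :: nat assume K: "K > 0"
    have "(\<Sum>j\<in>{-int K - 1..int K}. \<bar>x s j\<bar>) \<le> 4 * real K * B" if "s \<in> {a..b}" for s
    proof -
      have "(\<Sum>j\<in>{-int K - 1..int K}. \<bar>x s j\<bar>) \<le> real (card {-int K - 1..int K}) * B"
        using that by (intro sum_bounded_above bounded)
      also have "\<dots> \<le> 4 * real K * B"
        using K B by (intro mult_right_mono) auto
      finally show ?thesis .
    qed
    then have "(\<Sum>j\<in>{-int K..int K}. tent K j * \<bar>x t j\<bar>)
        \<le> Q + 2 * M / (h * real K) * (4 * real K * B) * (t - a)"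
      by (intro tent_growth K t)
    also have "\<dots> = Q + 8 * M / h * B * (t - a)"
      using K by simp
    also have "\<dots> \<le> Q'"
      unfolding Q'_def using M h B t by (intro add_left_mono mult_left_mono) auto
    finally show "(\<Sum>j\<in>{-int K..int K}. tent K j * \<bar>x t j\<bar>) \<le> Q' + 0 / real K"
      by simp
  qed
  show ?thesis
  proof (rule finite_sums_le_if_tent_sums_le[OF _ F])
    fix K :: nat assume K: "K > 0"
    have "(\<Sum>j\<in>{-int K..int K}. tent K j * \<bar>x b j\<bar>)
        \<le> Q + 2 * M / (h * real K) * Q' * (b - a)"
      using ab by (intro tent_growth K TV_bound) auto
    then show "(\<Sum>j\<in>{-int K..int K}. tent K j * \<bar>x b j\<bar>)
        \<le> Q + 2 * M / h * Q' * (b - a) / real K"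
      by simp
  qed
qed

section \<open>Increments of the interpolated values\<close>

text \<open>
  Consecutive interpolated values differ by a bounded nonnegative multiple \<open>e\<close> of the difference
  of the nodal values. With \<open>s = (b - a) / (c - b)\<close> and \<open>r = (c - b) / (d - c)\<close>, if these are
  defined and \<open>r\<close> is nonzero,
  \<open>e = 1 + \<phi>(r) / (2 r) - \<phi>(s) / 2\<close>. Here \<open>\<phi>(r) / r \<ge> \<alpha> - 2\<close> and \<open>\<phi>(s) \<le> \<alpha>\<close> give \<open>e \<ge> 0\<close>.
  The limiter bounds say nothing about \<open>\<phi>(r) / r\<close> from above when \<open>r > 0\<close> is small; that bound
  comes from the Lipschitz continuity of the interpolation, which returns \<open>c\<close> when \<open>b = c\<close>.
\<close>

lemma interp_L_increment:
  assumes lip: "C-lipschitz_on UNIV (\<lambda>(x, y, z). interp_L \<phi> x y z)"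
    and nonneg: "\<And>r. 0 \<le> \<phi> r" and le: "\<And>r. \<phi> r \<le> \<alpha>" and "\<alpha> \<le> 2"
    and le_nonpos: "\<And>r. r \<le> 0 \<Longrightarrow> \<phi> r \<le> (\<alpha> - 2) * r"
  shows "\<exists>e. 0 \<le> e \<and> e \<le> 1 + C \<and> interp_L \<phi> b c d - interp_L \<phi> a b c = e * (c - b)"
proof (cases "c = b")
  case True
  have "\<phi> 0 = 0"
    using le_nonpos[of 0] nonneg[of 0] by simp
  then have "interp_L \<phi> b c d - interp_L \<phi> a b c = 0 * (c - b)"
    using True by (simp add: interp_L_def)
  moreover have "0 \<le> 1 + C"
    using lipschitz_on_nonneg[OF lip] by simp
  ultimately show ?thesis
    by blast
next
  case False
  define s where "s = (b - a) / (c - b)"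
  \<comment> \<open>For \<open>d \<noteq> c\<close> this is \<open>\<phi>(r) / (2 r)\<close> with \<open>r = (c - b) / (d - c)\<close>; for \<open>d = c\<close> it is 0.\<close>
  define k where "k = (interp_L \<phi> b c d - c) / (c - b)"
  define e where "e = 1 + k - \<phi> s / 2"
  have "interp_L \<phi> b c d - interp_L \<phi> a b c = e * (c - b)"
    using False by (simp add: e_def s_def k_def interp_L_def[of \<phi> a b c] field_simps)
  moreover have "k \<ge> \<alpha> / 2 - 1"
  proof (cases "d = c")
    case True
    then show ?thesis
      using \<open>\<alpha> \<le> 2\<close> by (simp add: k_def interp_L_def)
  next
    case d: False
    define r where "r = (c - b) / (d - c)"
    have "r \<noteq> 0"
      using d False by (simp add: r_def)
    have k: "k = \<phi> r / r / 2"
      using d False by (simp add: k_def interp_L_def r_def)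
    show ?thesis
    proof (cases "r > 0")
      case True
      then have "k \<ge> 0"
        using nonneg[of r] by (simp add: k)
      then show ?thesis
        using \<open>\<alpha> \<le> 2\<close> by simp
    next
      case False
      then have "r < 0"
        using \<open>r \<noteq> 0\<close> by simp
      then have "\<phi> r / r \<ge> \<alpha> - 2"
        using le_nonpos[of r] by (simp add: neg_le_divide_eq)
      then show ?thesis
        by (simp add: k)
    qed
  qed
  moreover have "k \<le> C"
  proof -
    have "\<phi> 0 = 0"
      using le_nonpos[of 0] nonneg[of 0] by simp
    then have "interp_L \<phi> c c d = c"
      by (simp add: interp_L_def)
    then have "\<bar>interp_L \<phi> b c d - c\<bar> \<le> C * \<bar>c - b\<bar>"
      using lipschitz_onD[OF lip, of "(b, c, d)" "(c, c, d)"]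
      by (simp add: dist_Pair_Pair dist_real_def abs_minus_commute)
    then have "\<bar>k\<bar> \<le> C"
      using False by (simp add: k_def pos_divide_le_eq)
    then show ?thesis
      by simp
  qed
  ultimately show ?thesis
    using nonneg[of s] le[of s] by (intro exI[of _ e]) (simp add: e_def)
qed

lemma abs_interp_L_le:
  assumes "\<And>r. 0 \<le> \<phi> r" "\<And>r. \<phi> r \<le> 2" "\<bar>y\<bar> \<le> B" "\<bar>z\<bar> \<le> B"
  shows "\<bar>interp_L \<phi> x y z\<bar> \<le> B"
proof (cases "z = y")
  case True
  then show ?thesis
    using assms by (simp add: interp_L_def)
next
  case False
  define \<mu> where "\<mu> = \<phi> ((y - x) / (z - y)) / 2"
  have \<mu>: "0 \<le> \<mu>" "\<mu> \<le> 1"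
    using assms(1,2)[of "(y - x) / (z - y)"] by (auto simp: \<mu>_def)
  have "interp_L \<phi> x y z = y + \<mu> * (z - y)"
    using False by (simp add: interp_L_def \<mu>_def)
  also have "\<dots> = (1 - \<mu>) * y + \<mu> * z"
    by (simp add: algebra_simps)
  also have "\<bar>\<dots>\<bar> \<le> (1 - \<mu>) * \<bar>y\<bar> + \<mu> * \<bar>z\<bar>"
    using \<mu> by (intro abs_triangle_ineq[THEN order_trans]) (simp add: abs_mult)
  also have "\<dots> \<le> B"
    using \<mu> assms(3,4) by (intro convex_bound_le) auto
  finally show ?thesis .
qed

section \<open>Monotone fluxes\<close>

lemma abs_continuous_with_deriv_mono:
  assumes ac: "abs_continuous_with_deriv g g'" and nonneg: "AE x in lebesgue. 0 \<le> g' x"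
  shows "mono g"
proof (rule monoI)
  fix a b :: real assume "a \<le> b"
  have "0 \<le> (LINT \<xi>=ereal a..ereal b|lebesgue. g' \<xi>)"
    using \<open>a \<le> b\<close> nonneg
    unfolding interval_lebesgue_integral_def set_lebesgue_integral_def
    by (auto intro!: integral_nonneg_AE)
  then show "g a \<le> g b"
    using ac unfolding abs_continuous_with_deriv_def by (metis le_add_same_cancel1)
qed

lemma abs_continuous_with_deriv_uminus:
  assumes "abs_continuous_with_deriv g g'"
  shows "abs_continuous_with_deriv (\<lambda>x. - g x) (\<lambda>x. - g' x)"
  unfolding abs_continuous_with_deriv_def
proof (intro conjI allI)
  show "AE x in lebesgue. ((\<lambda>x. - g x) has_real_derivative - g' x) (at x)"
    using assms unfolding abs_continuous_with_deriv_def by (auto intro: DERIV_minus)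
  fix a b
  have int: "interval_lebesgue_integrable lebesgue (ereal a) (ereal b) g'"
    and eq: "g b = g a + (LINT \<xi>=ereal a..ereal b|lebesgue. g' \<xi>)"
    using assms unfolding abs_continuous_with_deriv_def by blast+
  show "interval_lebesgue_integrable lebesgue (ereal a) (ereal b) (\<lambda>x. - g' x)"
    using int by (auto simp: interval_lebesgue_integrable_def set_integrable_def)
  show "- g b = - g a + (LINT \<xi>=ereal a..ereal b|lebesgue. (- g' \<xi>))"
    using eq by (simp add: interval_lebesgue_integral_uminus)
qed

lemma mono_lipschitz_increment:
  fixes g :: "real \<Rightarrow> real"
  assumes "mono g"
    and lip: "\<bar>g y - g x\<bar> \<le> C * \<bar>y - x\<bar>" and "0 \<le> C"
    and e: "0 \<le> e" "e \<le> E" "y - x = e * d"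
  shows "sgn d * (g y - g x) = \<bar>g y - g x\<bar>" "\<bar>g y - g x\<bar> \<le> C * E * \<bar>d\<bar>"
proof -
  consider "d > 0" "x \<le> y" | "d = 0" "x = y" | "d < 0" "y \<le> x"
    using e by (smt (verit) mult_nonneg_nonneg mult_nonneg_nonpos mult_eq_0_iff)
  then show "sgn d * (g y - g x) = \<bar>g y - g x\<bar>"
    by cases (auto dest: monoD[OF \<open>mono g\<close>])
  have "C * \<bar>y - x\<bar> \<le> C * (E * \<bar>d\<bar>)"
    using e \<open>0 \<le> C\<close> by (intro mult_left_mono) (auto simp: abs_mult intro: mult_right_mono)
  then show "\<bar>g y - g x\<bar> \<le> C * E * \<bar>d\<bar>"
    using lip by simp
qed

section \<open>Decay of the total variation\<close>

lemma total_variation_le_iff: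
  assumes "0 \<le> Q"
  shows "total_variation v \<le> ennreal Q \<longleftrightarrow>
    (\<forall>F. finite F \<longrightarrow> (\<Sum>j\<in>F. \<bar>v (j + 1) - v j\<bar>) \<le> Q)"
proof -
  have "total_variation v = (SUP F\<in>{F. finite F}. ennreal (\<Sum>j\<in>F. \<bar>v (j + 1) - v j\<bar>))"
    unfolding total_variation_def by (simp add: nonneg_infsum_complete)
  then show ?thesis
    using assms by (auto simp: SUP_le_iff)
qed

theorem theorem3p1:
  fixes h T \<alpha> :: real
    and \<phi> f :: "real \<Rightarrow> real"
    and \<Phi> \<Phi>\<^sub>u \<Phi>\<^sub>v :: "real \<times> real \<Rightarrow> real"
    and u0 :: "int \<Rightarrow> real"
    and u :: "real \<Rightarrow> (int \<Rightarrow>\<^sub>C real)"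
  assumes h_pos: "h > 0"
    and limiter_le_1: "\<And>r. r \<le> 1 \<Longrightarrow> max 0 r \<le> \<phi> r \<and> \<phi> r \<le> 1"
    and limiter_ge_1: "\<And>r. r \<ge> 1 \<Longrightarrow> 1 \<le> \<phi> r \<and> \<phi> r \<le> min r 2"
    and limiter_inverse: "\<And>r. r \<ge> 1 \<Longrightarrow> \<phi> r \<le> r * \<phi> (1 / r)"
    and L_lipschitz: "\<exists>C. C-lipschitz_on UNIV (\<lambda>(x, y, z). interp_L \<phi> x y z)"
    and alpha: "1 \<le> \<alpha>" "\<alpha> \<le> 2"
    and limiter_alpha_nonpos: "\<And>r. r \<le> 0 \<Longrightarrow> \<phi> r \<le> (\<alpha> - 2) * r"
    and limiter_alpha_pos: "\<And>r. r > 0 \<Longrightarrow> \<phi> r \<le> \<alpha>"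
    and f_convex: "convex_on UNIV f"
    and f_C2: "C2_function f"
    and flux_consistent: "consistent_flux f \<Phi>"
    and flux_lipschitz: "\<And>K. compact K \<Longrightarrow> \<exists>C. C-lipschitz_on K \<Phi>"
    and flux_ac_fst: "\<And>v. abs_continuous_with_deriv (\<lambda>\<xi>. \<Phi> (\<xi>, v)) (\<lambda>\<xi>. \<Phi>\<^sub>u (\<xi>, v))"
    and flux_ac_snd: "\<And>u. abs_continuous_with_deriv (\<lambda>\<xi>. \<Phi> (u, \<xi>)) (\<lambda>\<xi>. \<Phi>\<^sub>v (u, \<xi>))"
    and flux_monotone_fst: "\<And>v. AE \<xi> in lebesgue. \<Phi>\<^sub>u (\<xi>, v) \<ge> 0"
    and flux_monotone_snd: "\<And>u. AE \<xi> in lebesgue. \<Phi>\<^sub>v (u, \<xi>) \<le> 0"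
    and u0_bounded: "bounded (range u0)"
    and u0_TV: "total_variation u0 < \<infinity>"
    and T_pos: "T > 0"
    and solution: "semidiscrete_solution h \<phi> \<Phi> T u0 u"
  shows "\<forall>t \<theta>. 0 \<le> t \<and> t \<le> t + \<theta> \<and> t + \<theta> \<le> T \<longrightarrow>
           total_variation (apply_bcontfun (u (t + \<theta>))) \<le> total_variation (apply_bcontfun (u t))"
proof (intro allI impI)
  fix t \<theta> assume t: "0 \<le> t \<and> t \<le> t + \<theta> \<and> t + \<theta> \<le> T"
  define v where "v s j = apply_bcontfun (u s) j" for s j
  have \<phi>_nonneg: "0 \<le> \<phi> r" for r
    using limiter_le_1[of r] limiter_ge_1[of r] by linarith
  have \<phi>_le: "\<phi> r \<le> \<alpha>" for r
    using limiter_le_1[of r] limiter_alpha_pos[of r] alpha by linarith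
  have \<phi>_le_2: "\<phi> r \<le> 2" for r
    using \<phi>_le[of r] alpha by linarith
  obtain C where C: "C-lipschitz_on UNIV (\<lambda>(x, y, z). interp_L \<phi> x y z)"
    using L_lipschitz by blast
  note increment = interp_L_increment[OF C \<phi>_nonneg \<phi>_le alpha(2) limiter_alpha_nonpos]
  have \<Phi>_mono_fst: "mono (\<lambda>\<xi>. \<Phi> (\<xi>, c))" for c
    using abs_continuous_with_deriv_mono[OF flux_ac_fst flux_monotone_fst] .
  have \<Phi>_mono_snd: "mono (\<lambda>\<xi>. - \<Phi> (c, \<xi>))" for c
    by (rule abs_continuous_with_deriv_mono[OF abs_continuous_with_deriv_uminus[OF flux_ac_snd]])
      (use flux_monotone_snd in simp)
  have "continuous_on {0..T} u"
    using solution unfolding semidiscrete_solution_def C1_bounded_seq_def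
    by (meson continuous_on_eq_continuous_within has_vector_derivative_continuous)
  then have "bounded (u ` {0..T})"
    by (intro compact_imp_bounded compact_continuous_image) auto
  then obtain B where B: "\<And>s. s \<in> {0..T} \<Longrightarrow> norm (u s) \<le> B"
    unfolding bounded_iff by blast
  have v_le: "\<bar>v s j\<bar> \<le> B" if "s \<in> {0..T}" for s j
    using norm_bounded[of "u s" j] B[OF that] by (simp add: v_def)
  obtain D where D: "D-lipschitz_on ({-B..B} \<times> {-B..B}) \<Phi>"
    using flux_lipschitz[of "{-B..B} \<times> {-B..B}"] by (auto intro: compact_Times)
  have D_nonneg: "0 \<le> D"
    using D by (rule lipschitz_on_nonneg)
  have minus_le: "\<bar>half_minus \<phi> (v s) j\<bar> \<le> B" and plus_le: "\<bar>half_plus \<phi> (v s) j\<bar> \<le> B"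
    if "s \<in> {0..T}" for s j
    unfolding half_minus_def half_plus_def interp_R_def
    by (intro abs_interp_L_le \<phi>_nonneg \<phi>_le_2 v_le that)+
  define p where "p s j = \<Phi> (half_minus \<phi> (v s) j, half_plus \<phi> (v s) (j - 1))
      - \<Phi> (half_minus \<phi> (v s) j, half_plus \<phi> (v s) j)" for s j
  define q where "q s j = \<Phi> (half_minus \<phi> (v s) j, half_plus \<phi> (v s) (j - 1))
      - \<Phi> (half_minus \<phi> (v s) (j - 1), half_plus \<phi> (v s) (j - 1))" for s j
  define x where "x s j = v s (j + 1) - v s j" for s j
  define M where "M = D * (1 + C)"
  have p: "sgn (x s j) * p s j = \<bar>p s j\<bar> \<and> \<bar>p s j\<bar> \<le> M * \<bar>x s j\<bar>"
    if s: "s \<in> {0..T}" for s j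
  proof -
    \<comment> \<open>The right values are left values of the reflected sequence.\<close>
    obtain e where e: "0 \<le> e" "e \<le> 1 + C"
      "interp_L \<phi> (v s (j + 1)) (v s j) (v s (j - 1))
        - interp_L \<phi> (v s (j + 2)) (v s (j + 1)) (v s j) = e * (v s j - v s (j + 1))"
      using increment by blast
    let ?m = "half_minus \<phi> (v s) j"
    have "half_plus \<phi> (v s) j - half_plus \<phi> (v s) (j - 1) = e * x s j"
      using e(3) by (simp add: half_plus_def interp_R_def x_def algebra_simps)
    moreover have "\<bar>- \<Phi> (?m, half_plus \<phi> (v s) j) - - \<Phi> (?m, half_plus \<phi> (v s) (j - 1))\<bar>
        \<le> D * \<bar>half_plus \<phi> (v s) j - half_plus \<phi> (v s) (j - 1)\<bar>"
      using lipschitz_onD[OF D, of "(?m, half_plus \<phi> (v s) j)" "(?m, half_plus \<phi> (v s) (j - 1))"]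
        minus_le[OF s, of j] plus_le[OF s, of j] plus_le[OF s, of "j - 1"]
      by (auto simp: dist_Pair_Pair dist_real_def abs_le_iff)
    ultimately show ?thesis
      using mono_lipschitz_increment[OF \<Phi>_mono_snd _ D_nonneg e(1,2)]
      by (simp add: p_def M_def)
  qed
  have q: "sgn (x s (j - 1)) * q s j = \<bar>q s j\<bar> \<and> \<bar>q s j\<bar> \<le> M * \<bar>x s (j - 1)\<bar>"
    if s: "s \<in> {0..T}" for s j
  proof -
    obtain e where e: "0 \<le> e" "e \<le> 1 + C"
      "interp_L \<phi> (v s (j - 1)) (v s j) (v s (j + 1))
        - interp_L \<phi> (v s (j - 2)) (v s (j - 1)) (v s j) = e * (v s j - v s (j - 1))"
      using increment by blast
    let ?c = "half_plus \<phi> (v s) (j - 1)"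
    have "half_minus \<phi> (v s) j - half_minus \<phi> (v s) (j - 1) = e * x s (j - 1)"
      using e(3) by (simp add: half_minus_def x_def)
    moreover have "\<bar>\<Phi> (half_minus \<phi> (v s) j, ?c) - \<Phi> (half_minus \<phi> (v s) (j - 1), ?c)\<bar>
        \<le> D * \<bar>half_minus \<phi> (v s) j - half_minus \<phi> (v s) (j - 1)\<bar>"
      using lipschitz_onD[OF D, of "(half_minus \<phi> (v s) j, ?c)" "(half_minus \<phi> (v s) (j - 1), ?c)"]
        plus_le[OF s, of "j - 1"] minus_le[OF s, of j] minus_le[OF s, of "j - 1"]
      by (auto simp: dist_Pair_Pair dist_real_def abs_le_iff)
    ultimately show ?thesis
      using mono_lipschitz_increment[OF \<Phi>_mono_fst _ D_nonneg e(1,2)]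
      by (simp add: q_def M_def)
  qed
  have deriv_v: "((\<lambda>s. v s j) has_real_derivative 1 / h * (p s j - q s j)) (at s within {0..T})"
    if "s \<in> {0..T}" for s j
  proof -
    have "((\<lambda>s. v s j) has_real_derivative
        - (1 / h) * (half_flux \<phi> \<Phi> (v s) j - half_flux \<phi> \<Phi> (v s) (j - 1))) (at s within {0..T})"
      using solution that unfolding semidiscrete_solution_def v_def by blast
    moreover have "- (1 / h) * (half_flux \<phi> \<Phi> (v s) j - half_flux \<phi> \<Phi> (v s) (j - 1))
        = 1 / h * (p s j - q s j)"
      by (simp add: half_flux_def p_def q_def right_diff_distrib)
    ultimately show ?thesis
      by simp
  qed
  have deriv_x: "((\<lambda>s. x s j) has_real_derivative
      1 / h * ((p s (j + 1) - q s (j + 1)) - (p s j - q s j))) (at s within {t..t + \<theta>})"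
    if "s \<in> {t..t + \<theta>}" for s j
  proof (rule DERIV_subset)
    have "((\<lambda>s. x s j) has_real_derivative
        1 / h * (p s (j + 1) - q s (j + 1)) - 1 / h * (p s j - q s j)) (at s within {0..T})"
      unfolding x_def using that t by (intro DERIV_diff deriv_v) auto
    then show "((\<lambda>s. x s j) has_real_derivative
        1 / h * ((p s (j + 1) - q s (j + 1)) - (p s j - q s j))) (at s within {0..T})"
      by (simp add: right_diff_distrib)
    show "{t..t + \<theta>} \<subseteq> {0..T}"
      using t by auto
  qed
  have x_le: "\<bar>x s j\<bar> \<le> 2 * B" if "s \<in> {0..T}" for s j
    using v_le[OF that, of j] v_le[OF that, of "j + 1"] by (simp add: x_def)
  show "total_variation (apply_bcontfun (u (t + \<theta>))) \<le> total_variation (apply_bcontfun (u t))"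
  proof (cases "total_variation (apply_bcontfun (u t))")
    case (real Q)
    then have init: "(\<Sum>j\<in>F. \<bar>x t j\<bar>) \<le> Q" if "finite F" for F
      using total_variation_le_iff[of Q "apply_bcontfun (u t)"] that by (simp add: x_def v_def)
    have "(\<Sum>j\<in>F. \<bar>x (t + \<theta>) j\<bar>) \<le> Q" if F: "finite F" for F
    proof (rule incremental_form_TVD[OF _ h_pos _ deriv_x _ _ _ _ _ init F, where B = "2 * B"])
      show "t \<le> t + \<theta>" "0 \<le> M"
        using t D_nonneg lipschitz_on_nonneg[OF C] by (auto simp: M_def)
    qed (use p q x_le t in auto)
    then show ?thesis
      unfolding real using real total_variation_le_iff[of Q "apply_bcontfun (u (t + \<theta>))"]
      by (simp add: x_def v_def)
  next
    case top
    then show ?thesis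
      by simp
  qed
qed

end
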